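(* $\mathbb{C}(\mathcal{Y}_2)=\mathbb{C}(T)$, where $T=\left(\dfrac{a}{a-2}\right)^2$.
   Context: $\mathcal{M}_2$ is the moduli space of genus 2 curves over $\mathbb{C}$. A degree 5 cover $\psi:C\to E$ from a genus 2 curve to a genus 1 curve induces a degree 5 cover $\phi:\mathbb{P}^1\to\mathbb{P}^1$ with $\phi\circ\pi_C=\pi_E\circ\psi$, where $\pi_C:C\to\mathbb{P}^1$, $\pi_E:E\to\mathbb{P}^1$ are the natural degree 2 covers. $\mathcal{Y}_2\subset\mathcal{M}_2$ is the locus of genus 2 curves $C$ admitting a degree 5 cover $\psi:C\to E$ to a genus 1 curve such that $\phi$ is of degenerate type II, i.e. has exactly four branch points, with ramification indices $>1$ over them given by $((2)^2,(2)^2,(2)\cdot(3),(2))$. Normal form: the curves in $\mathcal{Y}_2$ are those of the form $C_a:\ y^2=x(x-1)(b_3x^3+b_2x^2+b_1x+b_0)$ with $b_3=(2a+1)(9a-8)^2$, $b_2=-27a^6-54a^5+468a^4-958a^3+381a^2+400a-192$, $b_1=-18a^6+380a^5-1000a^4+726a^3+499a^2-752a+192$, $b_0=-(a+8)^2(a-1)^3(3a-1)$, where $a(9a-8)(a+8)(2a+1)(3a-1)(a-1)(a-2)\ne0$. The absolute invariants of a genus 2 curve are $i_1=144J_4/J_2^2$, $i_2=-1728(J_2J_4-3J_6)/J_2^3$, $i_3=486J_{10}/J_2^5$, where $J_2,J_4,J_6,J_{10}$ are the classical (Igusa) invariants of binary sextics. With $a$ transcendental over $\mathbb{C}$, the function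 field $\mathbb{C}(\mathcal{Y}_2)$ is regarded as the subfield of $\mathbb{C}(a)$ generated by the absolute invariants $i_1,i_2,i_3$ of $C_a$. *)

theory Defs
  imports
    "HOL-Algebra.Generated_Fields"
    "HOL-Algebra.Algebraic_Closure_Type"
    "HOL-Computational_Algebra.Fraction_Field"
    "Subresultants.Resultant_Prelim"
begin

section \<open>Classical invariants of binary sextics\<close>

text \<open>
  A polynomial \<open>f\<close> of degree at most 6 stands for the binary sextic
  \<open>F(X,Z) = (\<Sum>i\<le>6. coeff f i * X^i * Z^(6-i))\<close>; in particular a quintic is a sextic with a root
  at infinity, and all seven coefficients are used even if the leading one is 0.

  The invariants are normalised as in Igusa's absolute invariants
  \<open>i1 = 144 J4/J2^2\<close> etc., that is, \<open>J2, J4, J6, J10\<close> are the invariants \<open>A, B, C, D\<close> (often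
  called Igusa--Clebsch invariants). If \<open>f\<close> has leading coefficient \<open>u\<close> and roots \<open>x1, \<dots>, x6\<close>,
  and \<open>(ij) = xi - xj\<close>, then
  \<open>J2 = u^2 * (sum of 15 terms (12)^2 (34)^2 (56)^2)\<close>,
  \<open>J4 = u^4 * (sum of 10 terms (12)^2 (23)^2 (31)^2 (45)^2 (56)^2 (64)^2)\<close>,
  \<open>J6 = u^6 * (sum of 60 terms
      (12)^2 (23)^2 (31)^2 (45)^2 (56)^2 (64)^2 (14)^2 (25)^2 (36)^2)\<close> and
  \<open>J10 = u^10 * (product of (ij)^2 over all i < j)\<close>.
  The formulas below are these expressions written in terms of the coefficients.
\<close>

definition igusa_J2 :: "'a :: comm_ring_1 poly \<Rightarrow> 'a" where
  "igusa_J2 f =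
   (let a0 = coeff f 0; a1 = coeff f 1; a2 = coeff f 2; a3 = coeff f 3;
        a4 = coeff f 4; a5 = coeff f 5; a6 = coeff f 6 in
    - 240 * a0 * a6 + 40 * a1 * a5 - 16 * a2 * a4 + 6 * a3^2)"

definition igusa_J4 :: "'a :: comm_ring_1 poly \<Rightarrow> 'a" where
  "igusa_J4 f =
   (let a0 = coeff f 0; a1 = coeff f 1; a2 = coeff f 2; a3 = coeff f 3;
        a4 = coeff f 4; a5 = coeff f 5; a6 = coeff f 6 in
    1620 * a0^2 * a6^2 - 540 * a0 * a1 * a5 * a6 - 504 * a0 * a2 * a4 * a6
      + 300 * a0 * a2 * a5^2 + 324 * a0 * a3^2 * a6 - 180 * a0 * a3 * a4 * a5
      + 48 * a0 * a4^3 + 300 * a1^2 * a4 * a6 - 80 * a1^2 * a5^2 - 180 * a1 * a2 * a3 * a6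
      + 4 * a1 * a2 * a4 * a5 + 36 * a1 * a3^2 * a5 - 12 * a1 * a3 * a4^2 + 48 * a2^3 * a6
      - 12 * a2^2 * a3 * a5 + 4 * a2^2 * a4^2)"

definition igusa_J6 :: "'a :: comm_ring_1 poly \<Rightarrow> 'a" where
  "igusa_J6 f =
   (let a0 = coeff f 0; a1 = coeff f 1; a2 = coeff f 2; a3 = coeff f 3;
        a4 = coeff f 4; a5 = coeff f 5; a6 = coeff f 6 in
    - 119880 * a0^3 * a6^3 + 59940 * a0^2 * a1 * a5 * a6^2 + 20664 * a0^2 * a2 * a4 * a6^2
      - 18600 * a0^2 * a2 * a5^2 * a6 - 10044 * a0^2 * a3^2 * a6^2
      + 3060 * a0^2 * a3 * a4 * a5 * a6 + 2250 * a0^2 * a3 * a5^3 - 96 * a0^2 * a4^3 * a6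
      - 900 * a0^2 * a4^2 * a5^2 - 18600 * a0 * a1^2 * a4 * a6^2
      - 2240 * a0 * a1^2 * a5^2 * a6 + 3060 * a0 * a1 * a2 * a3 * a6^2
      + 3472 * a0 * a1 * a2 * a4 * a5 * a6 + 1600 * a0 * a1 * a2 * a5^3
      + 1818 * a0 * a1 * a3^2 * a5 * a6 - 876 * a0 * a1 * a3 * a4^2 * a6
      - 1860 * a0 * a1 * a3 * a4 * a5^2 + 616 * a0 * a1 * a4^3 * a5 - 96 * a0 * a2^3 * a6^2
      - 876 * a0 * a2^2 * a3 * a5 * a6 + 424 * a0 * a2^2 * a4^2 * a6
      - 640 * a0 * a2^2 * a4 * a5^2 - 468 * a0 * a2 * a3^2 * a4 * a6
      + 330 * a0 * a2 * a3^2 * a5^2 + 492 * a0 * a2 * a3 * a4^2 * a5 - 160 * a0 * a2 * a4^4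
      + 162 * a0 * a3^4 * a6 - 198 * a0 * a3^3 * a4 * a5 + 60 * a0 * a3^2 * a4^3
      + 2250 * a1^3 * a3 * a6^2 + 1600 * a1^3 * a4 * a5 * a6 - 320 * a1^3 * a5^3
      - 900 * a1^2 * a2^2 * a6^2 - 1860 * a1^2 * a2 * a3 * a5 * a6
      - 640 * a1^2 * a2 * a4^2 * a6 + 64 * a1^2 * a2 * a4 * a5^2
      + 330 * a1^2 * a3^2 * a4 * a6 + 176 * a1^2 * a3^2 * a5^2 + 26 * a1^2 * a3 * a4^2 * a5
      - 36 * a1^2 * a4^4 + 616 * a1 * a2^3 * a5 * a6 + 492 * a1 * a2^2 * a3 * a4 * a6
      + 26 * a1 * a2^2 * a3 * a5^2 + 28 * a1 * a2^2 * a4^2 * a5 - 198 * a1 * a2 * a3^3 * a6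
      - 238 * a1 * a2 * a3^2 * a4 * a5 + 76 * a1 * a2 * a3 * a4^3 + 72 * a1 * a3^4 * a5
      - 24 * a1 * a3^3 * a4^2 - 160 * a2^4 * a4 * a6 - 36 * a2^4 * a5^2
      + 60 * a2^3 * a3^2 * a6 + 76 * a2^3 * a3 * a4 * a5 - 24 * a2^3 * a4^3
      - 24 * a2^2 * a3^3 * a5 + 8 * a2^2 * a3^2 * a4^2)"

text \<open>
  The discriminant of the binary sextic \<open>F\<close>: the resultant of the two binary quintics
  \<open>\<partial>F/\<partial>X\<close> and \<open>\<partial>F/\<partial>Z\<close> (formal degrees 5 and 5) is \<open>-(6^4)\<close> times the discriminant.
  At \<open>Z = 1\<close>, these derivatives are \<open>f'\<close> and \<open>6 f - X f'\<close>, the latter by Euler's identity.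
  Unlike the resultant of \<open>f\<close> and \<open>f'\<close> divided by the leading coefficient, this is also correct
  when \<open>f\<close> has degree 5.
\<close>

definition igusa_J10 :: "'a :: field poly \<Rightarrow> 'a" where
  "igusa_J10 f =
     - resultant_sub 5 5 (pderiv f) (smult 6 f - [:0, 1:] * pderiv f) / 6 ^ 4"

definition abs_inv_i1 :: "'a :: field poly \<Rightarrow> 'a" where
  "abs_inv_i1 f = 144 * igusa_J4 f / igusa_J2 f ^ 2"

definition abs_inv_i2 :: "'a :: field poly \<Rightarrow> 'a" where
  "abs_inv_i2 f = - 1728 * (igusa_J2 f * igusa_J4 f - 3 * igusa_J6 f) / igusa_J2 f ^ 3"

definition abs_inv_i3 :: "'a :: field poly \<Rightarrow> 'a" where
  "abs_inv_i3 f = 486 * igusa_J10 f / igusa_J2 f ^ 5"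


section \<open>The family of curves\<close>

text \<open>
  The genus 2 curve \<open>C\<^sub>a\<close> with affine equation \<open>y^2 = sextic_C a\<close>.
\<close>

definition sextic_C :: "'a :: comm_ring_1 \<Rightarrow> 'a poly" where
  "sextic_C a =
   (let b3 = (2 * a + 1) * (9 * a - 8)^2;
        b2 = - 27 * a^6 - 54 * a^5 + 468 * a^4 - 958 * a^3 + 381 * a^2 + 400 * a - 192;
        b1 = - 18 * a^6 + 380 * a^5 - 1000 * a^4 + 726 * a^3 + 499 * a^2 - 752 * a + 192;
        b0 = - ((a + 8)^2 * (a - 1)^3 * (3 * a - 1))
    in [:0, 1:] * [:- 1, 1:] * [:b0, b1, b2, b3:])"


section \<open>Subfields of the rational function field\<close>

type_synonym ratfun = "complex poly fract"

definition ratfun_const :: "complex \<Rightarrow> ratfun" where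
  "ratfun_const c = Fraction_Field.Fract [:c:] 1"

definition ratfun_var :: ratfun where
  "ratfun_var = Fraction_Field.Fract [:0, 1:] 1"

text \<open>\<open>adjoin_C S\<close> is the subfield \<open>\<complex>(S)\<close> of \<open>\<complex>(a)\<close>.\<close>

definition adjoin_C :: "ratfun set \<Rightarrow> ratfun set" where
  "adjoin_C S = generate_field ring_of_type_algebra (range ratfun_const \<union> S)"

text \<open>
  The parameter of the family is \<open>ratfun_var\<close>, which is transcendental over the constants, so the
  finitely many excluded values of the parameter play no role here.
\<close>

definition function_field_Y2 :: "ratfun set" where
  "function_field_Y2 =
     adjoin_C {abs_inv_i1 (sextic_C ratfun_var),
               abs_inv_i2 (sextic_C ratfun_var),
               abs_inv_i3 (sextic_C ratfun_var)}"

end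

theory Submission
  imports Defs
begin

text \<open>
  Put \<open>s = (a - 2)\<^sup>2 / (a - 1)\<close>. Since \<open>s + 4 = a\<^sup>2 / (a - 1)\<close>, the function \<open>T\<close> of the
  theorem equals \<open>(s + 4) / s\<close>, so \<open>\<complex>(T) = \<complex>(s)\<close>, and this is the field of functions invariant
  under the involution \<open>a \<mapsto> a / (a - 1)\<close>.

  \<^bold>\<open>The absolute invariants lie in\<close> \<open>\<complex>(s)\<close>. The sextic of the family has the roots \<open>0\<close> and
  \<open>\<infinity>\<close>, say \<open>f\<^sub>a = c\<^sub>1 x + c\<^sub>2 x\<^sup>2 + c\<^sub>3 x\<^sup>3 + c\<^sub>4 x\<^sup>4 + c\<^sub>5 x\<^sup>5\<close>, and the
  involution reverses it: \<open>f\<close> at \<open>a / (a - 1)\<close> is \<open>x\<^sup>6 f\<^sub>a(1/x) / (a - 1)\<^sup>6\<close>. On such sextics the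
  Igusa invariants are polynomials in the four expressions \<open>c\<^sub>1 c\<^sub>5\<close>, \<open>c\<^sub>2 c\<^sub>4\<close>, \<open>c\<^sub>3\<close> and
  \<open>c\<^sub>1 c\<^sub>4\<^sup>2 + c\<^sub>2\<^sup>2 c\<^sub>5\<close>, which are unchanged under the reversal of the coefficients and
  under \<open>x \<mapsto> \<lambda> x\<close> up to a power of \<open>\<lambda>\<close>. On the family each of them is a power of \<open>a - 1\<close> times
  a polynomial in \<open>s\<close>, and so \<open>J2, J4, J6, J10\<close> become polynomials of degree 4, 8, 12, 13 in \<open>s\<close>, up
  to the factors \<open>m, m\<^sup>2, m\<^sup>3, m\<^sup>5\<close> with \<open>m = (a - 1)\<^sup>6 s (s + 4)\<close> (lemma \<open>igusa_sextic_C\<close>). These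
  factors cancel in the absolute invariants.

  \<^bold>\<open>Conversely,\<close> \<open>s\<close> \<^bold>\<open>lies in\<close> \<open>K = \<complex>(i\<^sub>1, i\<^sub>2, i\<^sub>3)\<close>. The reduced form of \<open>J10\<close> is a
  constant times \<open>s (s + 4)\<^sup>2 (9 s + 100)\<^sup>5 (6 s + 25)\<^sup>5\<close>. So \<open>i\<^sub>3\<close> has a simple zero at \<open>s = 0\<close>, and
  at its other finite zeros \<open>i\<^sub>1\<close> takes values different from \<open>i\<^sub>1(0)\<close>; also \<open>i\<^sub>1(\<infinity>) \<noteq> i\<^sub>1(0)\<close>. That is,
  the map \<open>(i\<^sub>1, i\<^sub>3)\<close> from the \<open>s\<close>-line is injective and unramified above its value at the single
  point \<open>s = 0\<close>, hence has degree one onto its image. The algebraic form of this argument is lemma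
  \<open>coordinate_in_subfield\<close>: the minimal polynomial of \<open>s\<close> over \<open>K\<close> divides the two polynomials
  \<open>N\<^sub>j(X) - i\<^sub>j D\<^sub>j(X)\<close> that express \<open>i\<^sub>j = N\<^sub>j(s) / D\<^sub>j(s)\<close> for \<open>j = 1, 3\<close>. By the
  Gauss lemma this divisibility survives the specialisation \<open>a = 2\<close>, that is \<open>s = 0\<close>, where the
  two polynomials have only the simple factor \<open>X\<close> in common.
\<close>


section \<open>Minimal polynomials over a subfield\<close>

text \<open>
  Subfields occur here as subsets of a type of class \<open>field\<close>, so that the polynomials over the
  big field form a type and divisibility among them is the ordinary one.
\<close>

locale subfield_set =
  fixes K :: "'a :: field set"
  assumes one [simp]: "1 \<in> K"
    and add [simp]: "x \<in> K \<Longrightarrow> y \<in> K \<Longrightarrow> x + y \<in> K"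
    and uminus [simp]: "x \<in> K \<Longrightarrow> - x \<in> K"
    and mult [simp]: "x \<in> K \<Longrightarrow> y \<in> K \<Longrightarrow> x * y \<in> K"
    and inverse [simp]: "x \<in> K \<Longrightarrow> inverse x \<in> K"
begin

lemma diff [simp]: "x \<in> K \<Longrightarrow> y \<in> K \<Longrightarrow> x - y \<in> K"
  using add[of x "- y"] by simp

lemma zero [simp]: "0 \<in> K"
  using diff[OF one one] by simp

lemma divide [simp]: "x \<in> K \<Longrightarrow> y \<in> K \<Longrightarrow> x / y \<in> K"
  by (simp add: divide_inverse)

lemma power [simp]: "x \<in> K \<Longrightarrow> x ^ n \<in> K"
  by (induction n) simp_all

definition coeffs_in :: "'a poly \<Rightarrow> bool" where
  "coeffs_in p \<longleftrightarrow> (\<forall>i. coeff p i \<in> K)"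

text \<open>
  Division of polynomials with coefficients in \<open>K\<close> does not leave \<open>K\<close>, so a polynomial of least
  degree among those over \<open>K\<close> that vanish at \<open>x\<close> divides all of them.
\<close>

lemma minimal_polynomial:
  assumes "p \<noteq> 0" "coeffs_in p" "poly p x = 0"
  obtains m where "m \<noteq> 0" "coeffs_in m" "poly m x = 0"
    "\<And>q. coeffs_in q \<Longrightarrow> poly q x = 0 \<Longrightarrow> m dvd q"
proof -
  let ?I = "\<lambda>m. m \<noteq> 0 \<and> coeffs_in m \<and> poly m x = 0"
  define m where "m = (ARG_MIN degree m. ?I m)"
  have m: "?I m" and least: "\<And>q. ?I q \<Longrightarrow> degree m \<le> degree q"
    using arg_min_natI[of ?I p degree] arg_min_nat_le[of ?I _ degree] assms
    unfolding m_def by blast+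
  have "m dvd q" if "coeffs_in q" "poly q x = 0" for q
    using that
  proof (induction "degree q" arbitrary: q rule: less_induct)
    case less
    show ?case
    proof (cases "q = 0")
      case False
      define r where "r = monom (lead_coeff q / lead_coeff m) (degree q - degree m) * m"
      have "degree m \<le> degree q" using least less.prems False by blast
      hence deg: "degree r = degree q"
        using m False by (simp add: r_def degree_mult_eq degree_monom_eq)
      have lead: "lead_coeff r = lead_coeff q"
        unfolding r_def lead_coeff_mult using m False by (simp add: degree_monom_eq)
      show ?thesis
      proof (cases "q - r = 0")
        case True
        thus ?thesis using r_def by (metis dvd_triv_right eq_iff_diff_eq_0)
      next
        case neq: False
        have "degree (q - r) < degree q"
        proof (rule ccontr)
          assume "\<not> degree (q - r) < degree q"
          hence "degree (q - r) = degree q"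
            using degree_diff_le[of q "degree q" r] deg by linarith
          hence "lead_coeff (q - r) = lead_coeff q - lead_coeff r" using deg by simp
          thus False using lead neq by (metis diff_self leading_coeff_0_iff)
        qed
        moreover have "coeffs_in (q - r)"
          using m less.prems by (simp add: coeffs_in_def r_def coeff_monom_mult)
        moreover have "poly (q - r) x = 0" using m less.prems by (simp add: r_def)
        ultimately have "m dvd q - r" using less.hyps by blast
        moreover have "m dvd r" by (simp add: r_def)
        ultimately show ?thesis by (metis dvd_add diff_add_cancel)
      qed
    qed simp
  qed
  thus ?thesis using that m by blast
qed

end


section \<open>Specialisation of the parameter\<close>

lemma dvd_specialise:
  fixes P :: "'a :: comm_ring_1 poly poly"
  assumes "P dvd Q"
  shows "map_poly (\<lambda>g. poly g \<alpha>) P dvd map_poly (\<lambda>g. poly g \<alpha>) Q"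
proof -
  interpret poly_hom: map_poly_comm_ring_hom "\<lambda>g. poly g \<alpha>" by standard auto
  show ?thesis using assms by (auto elim!: dvdE simp: poly_hom.hom_mult)
qed

text \<open>
  Specialisation never raises degrees, and degrees of factors add up; so if \<open>P\<close> keeps its degree,
  then so does each of its factors.
\<close>

lemma degree_specialise_dvd:
  fixes M P :: "'a :: idom poly poly"
  assumes "M dvd P" "map_poly (\<lambda>g. poly g \<alpha>) P \<noteq> 0"
    and "degree (map_poly (\<lambda>g. poly g \<alpha>) P) = degree P"
  shows "degree (map_poly (\<lambda>g. poly g \<alpha>) M) = degree M"
proof -
  interpret poly_hom: map_poly_comm_ring_hom "\<lambda>g. poly g \<alpha>" by standard auto
  let ?s = "map_poly (\<lambda>g. poly g \<alpha>)"
  obtain R where R: "P = M * R" using assms(1) by (elim dvdE)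
  have s: "?s P = ?s M * ?s R" unfolding R by (rule poly_hom.hom_mult)
  have "degree (?s M) + degree (?s R) = degree M + degree R"
    using assms(2,3) s R by (metis degree_mult_eq mult_eq_0_iff poly_hom.hom_zero)
  thus ?thesis using degree_map_poly_le[of "\<lambda>g. poly g \<alpha>" M] degree_map_poly_le[of "\<lambda>g. poly g \<alpha>" R]
    by linarith
qed

text \<open>
  Let \<open>P\<close> and \<open>Q\<close> have coefficients in \<open>K\<close> up to scaling and vanish at \<open>x\<close>. A common factor of
  degree \<open>d\<close> over \<open>k(a)\<close>, in particular the minimal polynomial of \<open>x\<close> over \<open>K\<close>, can be made
  primitive over \<open>k[a]\<close>. By the Gauss lemma it then divides \<open>P\<close> and \<open>Q\<close> over \<open>k[a]\<close>, and it
  specialises to a common factor of degree \<open>d\<close> of the specialised polynomials. If these have no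
  common factor of degree above 1, then the minimal polynomial is linear.
\<close>

lemma root_in_subfield_by_specialisation:
  fixes P Q :: "'k :: field_gcd poly poly" and K :: "'k poly fract set" and \<alpha> :: 'k
  defines "spec \<equiv> map_poly (\<lambda>g. poly g \<alpha>)"
  assumes "subfield_set K"
    and P: "subfield_set.coeffs_in K (smult c (fract_poly P))" "c \<noteq> 0" "poly (fract_poly P) x = 0"
    and Q: "subfield_set.coeffs_in K (smult d (fract_poly Q))" "d \<noteq> 0" "poly (fract_poly Q) x = 0"
    and spec_P: "spec P \<noteq> 0" "degree (spec P) = degree P"
    and common: "\<And>R. R dvd spec P \<Longrightarrow> R dvd spec Q \<Longrightarrow> degree R \<le> 1"
  shows "x \<in> K"
proof -
  interpret subfield_set K by fact
  have "smult c (fract_poly P) \<noteq> 0" using spec_P(1) P(2) by (auto simp: spec_def)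
  moreover have "poly (smult c (fract_poly P)) x = 0" using P(3) by simp
  ultimately obtain m where m: "m \<noteq> 0" "coeffs_in m" "poly m x = 0"
    and m_dvd: "\<And>q. coeffs_in q \<Longrightarrow> poly q x = 0 \<Longrightarrow> m dvd q"
    using minimal_polynomial P(1) by blast
  have "m dvd smult c (fract_poly P)" "m dvd smult d (fract_poly Q)"
    using m_dvd P Q by simp_all
  hence m_PQ: "m dvd fract_poly P" "m dvd fract_poly Q"
    using P(2) Q(2) by (simp_all add: dvd_smult_cancel)
  obtain b M where M: "m = smult b (fract_poly M)" "content M = 1"
    by (rule content_decompose_fract)
  have "b \<noteq> 0" using M m(1) by auto
  hence "fract_poly M dvd fract_poly P" "fract_poly M dvd fract_poly Q"
    using m_PQ unfolding M by (simp_all add: smult_dvd_iff)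
  hence M_PQ: "M dvd P" "M dvd Q" using M(2) by (blast intro: fract_poly_dvdD)+
  have "degree m = degree M" using \<open>b \<noteq> 0\<close> unfolding M by (simp add: degree_map_poly)
  also have "\<dots> = degree (spec M)"
    using degree_specialise_dvd[OF M_PQ(1)] spec_P unfolding spec_def by simp
  also have "\<dots> \<le> 1"
    using common M_PQ dvd_specialise unfolding spec_def by blast
  finally have "degree m \<le> 1" .
  then obtain m0 m1 where m01: "m = [:m0, m1:]"
    by (metis degree_eq_zeroE le_Suc_eq le_zero_eq One_nat_def degree1_coeffs pCons_0_0 pCons_eq_iff)
  have "m1 \<noteq> 0" using m(1,3) unfolding m01 by auto
  have "m0 \<in> K" "m1 \<in> K" using m(2) unfolding m01 coeffs_in_def
    by (metis coeff_pCons_0, metis coeff_pCons_0 coeff_pCons_Suc)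
  moreover have "x = - (m0 / m1)"
    using m(3) \<open>m1 \<noteq> 0\<close> unfolding m01 by (simp add: field_simps add_eq_0_iff)
  ultimately show ?thesis by simp
qed


section \<open>Recovering a coordinate from two functions of it\<close>

text \<open>
  For \<open>degree N \<le> k\<close>, this is \<open>V\<^sup>k N(U / V)\<close>, the value at \<open>(U, V)\<close> of the form of degree \<open>k\<close>
  that belongs to \<open>N\<close>.
\<close>

definition clear_denoms :: "nat \<Rightarrow> 'k :: comm_ring_1 poly \<Rightarrow> 'k poly \<Rightarrow> 'k poly \<Rightarrow> 'k poly" where
  "clear_denoms k U V N = (\<Sum>i\<le>k. smult (coeff N i) (U ^ i * V ^ (k - i)))"

lemma poly_sum_upto:
  fixes x :: "'a :: comm_ring_1"
  assumes "degree N \<le> k"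
  shows "poly N x = (\<Sum>i\<le>k. coeff N i * x ^ i)"
  unfolding poly_altdef using assms
  by (intro sum.mono_neutral_left) (auto simp: coeff_eq_0)

lemma poly_clear_denoms:
  fixes \<alpha> :: "'k :: field"
  assumes "degree N \<le> k" "poly V \<alpha> \<noteq> 0"
  shows "poly (clear_denoms k U V N) \<alpha> = poly V \<alpha> ^ k * poly N (poly U \<alpha> / poly V \<alpha>)"
  unfolding clear_denoms_def poly_sum_upto[OF assms(1)] poly_sum sum_distrib_left
  using assms(2) by (intro sum.cong refl) (simp add: power_divide power_diff)

definition const_fract :: "'k :: field \<Rightarrow> 'k poly fract" where
  "const_fract c = to_fract [:c:]"

lemma const_fract_hom [simp]:
  fixes c d :: "'k :: field"
  shows "const_fract (0 :: 'k) = 0" "const_fract (1 :: 'k) = 1"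
  "const_fract (c + d) = const_fract c + const_fract d"
  "const_fract (c * d) = const_fract c * const_fract d"
  "const_fract (- c) = - const_fract c"
  "const_fract (c - d) = const_fract c - const_fract d"
  "const_fract (c ^ n) = const_fract c ^ n"
  "const_fract (numeral w :: 'k) = numeral w"
proof -
  have add: "const_fract (x + y) = const_fract x + const_fract y" for x y :: 'k
    unfolding const_fract_def to_fract_add[symmetric] by simp
  have mult: "const_fract (x * y) = const_fract x * const_fract y" for x y :: 'k
    unfolding const_fract_def to_fract_mult[symmetric] by simp
  have one: "const_fract 1 = (1 :: 'k poly fract)"
    unfolding const_fract_def by (simp add: pCons_one)
  show "const_fract (c + d) = const_fract c + const_fract d"
    "const_fract (c * d) = const_fract c * const_fract d"
    "const_fract 1 = (1 :: 'k poly fract)" by (fact add mult one)+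
  show "const_fract 0 = (0 :: 'k poly fract)"
    unfolding const_fract_def by simp
  show "const_fract (- c) = - const_fract c"
    unfolding const_fract_def to_fract_uminus[symmetric] by simp
  show "const_fract (c - d) = const_fract c - const_fract d"
    unfolding const_fract_def to_fract_diff[symmetric] by simp
  show "const_fract (c ^ n) = const_fract c ^ n"
    by (induction n) (simp_all add: one mult)
  show "const_fract (numeral w :: 'k) = numeral w"
    by (induction w) (simp_all only: numeral.simps one add)
qed

definition fract_eval :: "'k :: field poly \<Rightarrow> 'k poly fract \<Rightarrow> 'k poly fract" where
  "fract_eval p x = poly (map_poly const_fract p) x"

lemma fract_eval_simps [simp]:
  "fract_eval 0 x = 0" "fract_eval (pCons c p) x = const_fract c + x * fract_eval p x"
  "fract_eval (p + q) x = fract_eval p x + fract_eval q x"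
  "fract_eval (- p) x = - fract_eval p x" "fract_eval (p - q) x = fract_eval p x - fract_eval q x"
  "fract_eval (smult c p) x = const_fract c * fract_eval p x"
  "fract_eval (p * q) x = fract_eval p x * fract_eval q x"
  "fract_eval (p ^ n) x = fract_eval p x ^ n"
proof -
  interpret const_fract: map_poly_comm_ring_hom "const_fract :: 'a \<Rightarrow> _" by standard simp_all
  have pCons: "map_poly const_fract (pCons c p) = pCons (const_fract c) (map_poly const_fract p)"
    by (rule poly_eqI) (simp add: coeff_map_poly coeff_pCons split: nat.split)
  show "fract_eval 0 x = 0" "fract_eval (pCons c p) x = const_fract c + x * fract_eval p x"
    "fract_eval (p + q) x = fract_eval p x + fract_eval q x"
    "fract_eval (- p) x = - fract_eval p x" "fract_eval (p - q) x = fract_eval p x - fract_eval q x"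
    "fract_eval (smult c p) x = const_fract c * fract_eval p x"
    "fract_eval (p * q) x = fract_eval p x * fract_eval q x"
    "fract_eval (p ^ n) x = fract_eval p x ^ n"
    unfolding fract_eval_def
    by (simp_all add: pCons map_poly_smult const_fract.hom_add const_fract.hom_uminus const_fract.hom_minus
      const_fract.hom_mult const_fract.hom_power)
qed

lemma fract_eval_in_subfield:
  assumes "subfield_set K" "range const_fract \<subseteq> K" "x \<in> K"
  shows "fract_eval p x \<in> K"
proof -
  interpret subfield_set K by fact
  have "const_fract c \<in> K" for c using assms(2) by blast
  with assms(3) show ?thesis by (induction p) simp_all
qed

lemma to_fract_clear_denoms:
  assumes "degree N \<le> k" "V \<noteq> 0"
  shows "to_fract (clear_denoms k U V N) =
    to_fract V ^ k * fract_eval N (to_fract U / to_fract V)"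
proof -
  have pow: "to_fract (f ^ n) = to_fract f ^ n" for f :: "'a poly" and n
    by (induction n) simp_all
  have smult: "to_fract (smult c f) = const_fract c * to_fract f" for c and f :: "'a poly"
    unfolding const_fract_def to_fract_mult[symmetric] by simp
  have "degree (map_poly const_fract N) \<le> k"
    using degree_map_poly_le[of const_fract N] assms(1) by linarith
  note sum = poly_sum_upto[OF this]
  have "to_fract V ^ (k - i) = to_fract V ^ k / to_fract V ^ i" if "i \<le> k" for i
    using that assms(2) by (simp add: power_diff)
  thus ?thesis
    unfolding clear_denoms_def fract_eval_def sum sum_distrib_left
    by (auto intro!: sum.cong simp: smult pow power_divide coeff_map_poly)
qed

text \<open>
  The zeros of this polynomial are the points at which \<open>N / D\<close> takes the same value as at \<open>\<beta>\<close>.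
\<close>

definition fibre :: "'k :: field poly \<Rightarrow> 'k poly \<Rightarrow> 'k \<Rightarrow> 'k poly" where
  "fibre N D \<beta> = smult (poly D \<beta>) N - smult (poly N \<beta>) D"

text \<open>
  Let the functions \<open>f = N\<^sub>1(s) / D\<^sub>1(s)\<close> and \<open>g = N\<^sub>2(s) / D\<^sub>2(s)\<close> be defined at \<open>s = \<beta>\<close>. If
  \<open>\<beta>\<close> is the only point of the line above \<open>(f(\<beta>), g(\<beta>))\<close>, and \<open>f\<close> or \<open>g\<close> is unramified
  there, then \<open>(f, g)\<close> maps the line birationally to its image, and \<open>s\<close> is a rational function
  of \<open>f\<close> and \<open>g\<close>. The hypothesis on common divisors says this for the finite points, and the one
  on the degree of the first fibre says that \<open>s = \<infinity>\<close> is not in that fibre.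
\<close>

lemma coordinate_in_subfield:
  fixes U V N\<^sub>1 D\<^sub>1 N\<^sub>2 D\<^sub>2 :: "'k :: field_gcd poly" and \<alpha> :: 'k
  defines "s \<equiv> to_fract U / to_fract V" and "\<beta> \<equiv> poly U \<alpha> / poly V \<alpha>"
  defines "val N \<equiv> fract_eval N s"
  assumes K: "subfield_set K" "range const_fract \<subseteq> K"
    and f: "val N\<^sub>1 / val D\<^sub>1 \<in> K" and g: "val N\<^sub>2 / val D\<^sub>2 \<in> K"
    and defined: "poly V \<alpha> \<noteq> 0" "poly D\<^sub>1 \<beta> \<noteq> 0" "poly D\<^sub>2 \<beta> \<noteq> 0"
    and deg: "degree N\<^sub>1 \<le> k" "degree D\<^sub>1 \<le> k" "degree (fibre N\<^sub>1 D\<^sub>1 \<beta>) = k"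
    and nz: "fibre N\<^sub>1 D\<^sub>1 \<beta> \<noteq> 0"
    and common: "\<And>R. R dvd fibre N\<^sub>1 D\<^sub>1 \<beta> \<Longrightarrow> R dvd fibre N\<^sub>2 D\<^sub>2 \<beta> \<Longrightarrow> degree R \<le> 1"
  shows "s \<in> K"
proof -
  interpret subfield_set K by fact
  have "V \<noteq> 0" using defined(1) by auto
  let ?lift = "map_poly (\<lambda>c. [:c:])"
  let ?spec = "map_poly (\<lambda>g. poly g \<alpha>)"
  define rel where "rel n N D = smult (clear_denoms n U V D) (?lift N) - smult (clear_denoms n U V N) (?lift D)"
    for n N D
  \<comment> \<open>\<open>rel n N D\<close> is \<open>V\<^sup>n (D(s) N(X) - N(s) D(X))\<close>, a polynomial in \<open>X\<close> over \<open>k[a]\<close> which vanishes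
    at \<open>X = s\<close>. Divided by \<open>V\<^sup>n D(s)\<close> it is \<open>N(X) - f D(X)\<close> with \<open>f = N(s) / D(s)\<close>, hence over \<open>K\<close>
    when \<open>f\<close> is in \<open>K\<close>; at \<open>a = \<alpha>\<close> it becomes the fibre through \<open>\<beta>\<close>.\<close>
  have spec_rel: "?spec (rel n N D) = smult (poly V \<alpha> ^ n) (fibre N D \<beta>)"
    if "degree N \<le> n" "degree D \<le> n" for n N D
    by (rule poly_eqI)
       (simp add: rel_def fibre_def coeff_map_poly poly_clear_denoms[OF that(1) defined(1)]
         poly_clear_denoms[OF that(2) defined(1)] \<beta>_def algebra_simps)
  have fract_rel: "fract_poly (rel n N D) =
      smult (to_fract V ^ n) (smult (val D) (map_poly const_fract N) - smult (val N) (map_poly const_fract D))"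
    if "degree N \<le> n" "degree D \<le> n" for n N D
    by (rule poly_eqI)
       (simp add: rel_def coeff_map_poly to_fract_clear_denoms[OF that(1) \<open>V \<noteq> 0\<close>]
         to_fract_clear_denoms[OF that(2) \<open>V \<noteq> 0\<close>] val_def s_def const_fract_def algebra_simps)
  have root: "poly (fract_poly (rel n N D)) s = 0"
    if "degree N \<le> n" "degree D \<le> n" for n N D
    unfolding fract_rel[OF that] by (simp add: val_def fract_eval_def)
  have val_nz: "val D \<noteq> 0" if "poly D \<beta> \<noteq> 0" for D
  proof
    assume "val D = 0"
    hence "clear_denoms (degree D) U V D = 0"
      using to_fract_clear_denoms[OF order.refl \<open>V \<noteq> 0\<close>, of D U]
      unfolding val_def s_def by simp
    hence "poly (clear_denoms (degree D) U V D) \<alpha> = 0" by simp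
    thus False using poly_clear_denoms[OF order.refl defined(1), of D U] that defined(1)
      unfolding \<beta>_def by simp
  qed
  have coeffs: "coeffs_in (smult (1 / (to_fract V ^ n * val D)) (fract_poly (rel n N D)))"
    if "degree N \<le> n" "degree D \<le> n" "poly D \<beta> \<noteq> 0" "val N / val D \<in> K" for n N D
  proof -
    have "coeff (smult (1 / (to_fract V ^ n * val D)) (fract_poly (rel n N D))) i =
        const_fract (coeff N i) - val N / val D * const_fract (coeff D i)" for i
      unfolding fract_rel[OF that(1,2)] using val_nz[OF that(3)] \<open>V \<noteq> 0\<close>
      by (simp add: coeff_map_poly divide_simps)
    moreover have "const_fract c \<in> K" for c using K(2) by blast
    ultimately show ?thesis unfolding coeffs_in_def using that(4) by (metis diff mult)
  qed
  define l where "l = max (degree N\<^sub>2) (degree D\<^sub>2)"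
  have l: "degree N\<^sub>2 \<le> l" "degree D\<^sub>2 \<le> l" by (simp_all add: l_def)
  have unit: "poly V \<alpha> ^ n \<noteq> 0" for n using defined(1) by simp
  have deg_rel: "degree (rel k N\<^sub>1 D\<^sub>1) = k"
  proof (rule antisym)
    have lift: "degree (?lift N) \<le> k" if "degree N \<le> k" for N :: "'k poly"
      using degree_map_poly_le[of "\<lambda>c. [:c:]" N] that by linarith
    thus "degree (rel k N\<^sub>1 D\<^sub>1) \<le> k" unfolding rel_def
      by (intro degree_diff_le order.trans[OF degree_smult_le] lift deg)
    show "k \<le> degree (rel k N\<^sub>1 D\<^sub>1)"
      using degree_map_poly_le[of "\<lambda>g. poly g \<alpha>" "rel k N\<^sub>1 D\<^sub>1"] deg(3) defined(1)
      unfolding spec_rel[OF deg(1,2)] by simp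
  qed
  show ?thesis
  proof (rule root_in_subfield_by_specialisation[OF K(1)])
    show "coeffs_in (smult (1 / (to_fract V ^ k * val D\<^sub>1)) (fract_poly (rel k N\<^sub>1 D\<^sub>1)))"
      using coeffs deg defined f by blast
    show "coeffs_in (smult (1 / (to_fract V ^ l * val D\<^sub>2)) (fract_poly (rel l N\<^sub>2 D\<^sub>2)))"
      using coeffs l defined g by blast
    show "1 / (to_fract V ^ k * val D\<^sub>1) \<noteq> 0" "1 / (to_fract V ^ l * val D\<^sub>2) \<noteq> 0"
      using \<open>V \<noteq> 0\<close> val_nz defined by simp_all
    show "poly (fract_poly (rel k N\<^sub>1 D\<^sub>1)) s = 0" "poly (fract_poly (rel l N\<^sub>2 D\<^sub>2)) s = 0"
      using root deg l by blast+
    show "?spec (rel k N\<^sub>1 D\<^sub>1) \<noteq> 0" "degree (?spec (rel k N\<^sub>1 D\<^sub>1)) = degree (rel k N\<^sub>1 D\<^sub>1)"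
      unfolding spec_rel[OF deg(1,2)] deg_rel using nz unit deg(3) by simp_all
    fix R assume "R dvd ?spec (rel k N\<^sub>1 D\<^sub>1)" "R dvd ?spec (rel l N\<^sub>2 D\<^sub>2)"
    thus "degree R \<le> 1"
      unfolding spec_rel[OF deg(1,2)] spec_rel[OF l] using common unit by (simp add: dvd_smult_iff)
  qed
qed


section \<open>Subfields of the rational function field\<close>

lemma ratfun_const_eq: "ratfun_const = const_fract"
  by (rule ext) (simp add: ratfun_const_def const_fract_def to_fract_def)

lemma ratfun_numeral_nonzero: "(numeral n :: ratfun) \<noteq> 0"
  unfolding const_fract_hom(8)[symmetric] const_fract_def by (simp del: const_fract_hom)

lemma adjoin_C_const: "ratfun_const c \<in> adjoin_C S"
  and adjoin_C_incl: "x \<in> S \<Longrightarrow> x \<in> adjoin_C S"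
  unfolding adjoin_C_def by (auto intro: generate_field.incl)

lemma inv_ring_of_type_algebra:
  fixes x :: "'a :: field"
  assumes "x \<noteq> 0"
  shows "inv\<^bsub>ring_of_type_algebra\<^esub> x = inverse x"
proof -
  interpret field "ring_of_type_algebra :: 'a ring" by (rule field_from_type_algebra)
  show ?thesis using assms
    by (intro inv_char) (simp_all add: ring_of_type_algebra_def)
qed

lemma uminus_ring_of_type_algebra:
  fixes x :: "'a :: field"
  shows "\<ominus>\<^bsub>ring_of_type_algebra\<^esub> x = - x"
proof -
  interpret field "ring_of_type_algebra :: 'a ring" by (rule field_from_type_algebra)
  show ?thesis
    by (rule minus_equality) (simp_all add: ring_of_type_algebra_def)
qed

lemma subfield_set_adjoin_C: "subfield_set (adjoin_C S)"
proof
  let ?R = "ring_of_type_algebra :: ratfun ring"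
  have ops: "\<one>\<^bsub>?R\<^esub> = 1" "\<zero>\<^bsub>?R\<^esub> = 0" "x \<oplus>\<^bsub>?R\<^esub> y = x + y" "x \<otimes>\<^bsub>?R\<^esub> y = x * y" for x y
    by (simp_all add: ring_of_type_algebra_def)
  fix x y assume xy: "x \<in> adjoin_C S"
  show "- x \<in> adjoin_C S"
    using generate_field.a_inv[of x ?R] xy
    unfolding adjoin_C_def uminus_ring_of_type_algebra by blast
  show "inverse x \<in> adjoin_C S"
    using generate_field.m_inv[of x ?R] xy inv_ring_of_type_algebra[of x]
    unfolding adjoin_C_def ops by (cases "x = 0") simp_all
  assume "y \<in> adjoin_C S"
  with xy show "x + y \<in> adjoin_C S" "x * y \<in> adjoin_C S"
    using generate_field.eng_add[of x ?R _ y] generate_field.eng_mult[of x ?R _ y]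
    unfolding adjoin_C_def ops by blast+
next
  show "1 \<in> adjoin_C S"
    using generate_field.one[of ring_of_type_algebra] unfolding adjoin_C_def
    by (simp add: ring_of_type_algebra_def)
qed

lemma adjoin_C_least:
  assumes K: "subfield_set K" "range ratfun_const \<subseteq> K" "S \<subseteq> K"
  shows "adjoin_C S \<subseteq> K"
proof
  interpret subfield_set K by fact
  fix x assume "x \<in> adjoin_C S"
  thus "x \<in> K" unfolding adjoin_C_def
  proof induction
    case (m_inv h)
    hence "h \<noteq> 0" by (simp add: ring_of_type_algebra_def)
    with m_inv show ?case by (simp add: inv_ring_of_type_algebra)
  qed (use K in \<open>auto simp: uminus_ring_of_type_algebra\<close>, auto simp: ring_of_type_algebra_def)
qed


section \<open>Expansion of sparse determinants\<close>

text \<open>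
  Matrix entries are optional values, and \<open>None\<close> stands for 0. The expansion along the first
  column can then skip the zero entries by pattern matching, where a test \<open>x = 0\<close> would be
  undecided for a symbolic entry; this keeps the expansion of a Sylvester matrix short.
\<close>

primrec entry :: "'a::zero option \<Rightarrow> 'a" where
  "entry None = 0" | "entry (Some x) = x"

definition sparse_mat :: "nat \<Rightarrow> 'a::comm_ring_1 option list list \<Rightarrow> 'a mat" where
  "sparse_mat n xss = mat n n (\<lambda>(i, j). entry (xss ! i ! j))"

text \<open>
  The alternating sum of the first column entries times their minors. The minors are evaluated
  by \<open>d\<close>, and \<open>pre\<close> collects the rows already passed, without their first entries.
\<close>

fun first_column :: "('a::comm_ring_1 option list list \<Rightarrow> 'a) \<Rightarrow> 'a option list list \<Rightarrow> 'a option list list \<Rightarrow> 'a" where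
  "first_column d pre [] = 0"
| "first_column d pre ((None # r) # post) = - first_column d (pre @ [r]) post"
| "first_column d pre ((Some x # r) # post) =
     x * d (pre @ map tl post) - first_column d (pre @ [r]) post"
| "first_column d pre ([] # post) = 0"

primrec sparse_det :: "nat \<Rightarrow> 'a::comm_ring_1 option list list \<Rightarrow> 'a" where
  "sparse_det 0 xss = 1"
| "sparse_det (Suc n) xss = first_column (sparse_det n) [] xss"

lemma first_column_eq_sum:
  assumes "\<forall>r\<in>set post. r \<noteq> []"
  shows "first_column d pre post =
    (\<Sum>i<length post. (-1) ^ i * entry (hd (post ! i)) *
        d (pre @ map tl (take i post @ drop (Suc i) post)))"
  using assms
proof (induction d pre post rule: first_column.induct)
  case (2 d pre r post)
  then show ?case
    by (simp add: sum.lessThan_Suc_shift del: sum.lessThan_Suc)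
       (simp add: sum_negf[symmetric])
next
  case (3 d pre x r post)
  then show ?case
    by (simp add: sum.lessThan_Suc_shift del: sum.lessThan_Suc)
       (simp add: sum_negf[symmetric] diff_conv_add_uminus del: add_uminus_conv_diff)
qed auto

lemma det_sparse_mat:
  assumes "length xss = n" "\<forall>r\<in>set xss. length r = n"
  shows "det (sparse_mat n xss) = sparse_det n xss"
  using assms
proof (induction n arbitrary: xss)
  case 0
  then show ?case by (simp add: sparse_mat_def)
next
  case (Suc n)
  have minor: "det (mat_delete (sparse_mat (Suc n) xss) i 0) =
      sparse_det n (map tl (take i xss @ drop (Suc i) xss))" if "i < Suc n" for i
  proof -
    let ?M = "map tl (take i xss @ drop (Suc i) xss)"
    have len: "length ?M = n" "\<forall>r\<in>set ?M. length r = n"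
      using Suc.prems that by (auto dest: in_set_takeD in_set_dropD)
    have "mat_delete (sparse_mat (Suc n) xss) i 0 = sparse_mat n ?M"
    proof (rule eq_matI)
      fix k j assume "k < dim_row (sparse_mat n ?M)" "j < dim_col (sparse_mat n ?M)"
      hence kj: "k < n" "j < n" by (simp_all add: sparse_mat_def)
      have row: "?M ! k = tl (xss ! (if k < i then k else Suc k))"
        using kj that Suc.prems len by (auto simp: nth_append min_def)
      have "length (xss ! (if k < i then k else Suc k)) = Suc n"
        using kj Suc.prems by (auto intro!: nth_mem)
      thus "mat_delete (sparse_mat (Suc n) xss) i 0 $$ (k, j) = sparse_mat n ?M $$ (k, j)"
        using kj unfolding mat_delete_def sparse_mat_def
        by (simp add: row nth_tl del: map_append)
    qed (simp_all add: sparse_mat_def mat_delete_def)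
    thus ?thesis using Suc.IH[OF len] by simp
  qed
  have ne: "\<forall>r\<in>set xss. r \<noteq> []" using Suc.prems by auto
  have "det (sparse_mat (Suc n) xss) =
    (\<Sum>i<Suc n. sparse_mat (Suc n) xss $$ (i, 0) * cofactor (sparse_mat (Suc n) xss) i 0)"
    by (rule laplace_expansion_column) (simp_all add: sparse_mat_def)
  also have "\<dots> = (\<Sum>i<Suc n. (-1) ^ i * entry (hd (xss ! i)) *
        sparse_det n (map tl (take i xss @ drop (Suc i) xss)))"
  proof (rule sum.cong[OF refl])
    fix i assume "i \<in> {..<Suc n}"
    moreover from this have "xss ! i \<noteq> []" using Suc.prems ne by (auto intro!: nth_mem)
    ultimately show "sparse_mat (Suc n) xss $$ (i, 0) * cofactor (sparse_mat (Suc n) xss) i 0 =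
        (-1) ^ i * entry (hd (xss ! i)) * sparse_det n (map tl (take i xss @ drop (Suc i) xss))"
      by (simp add: cofactor_def minor) (simp add: sparse_mat_def hd_conv_nth)
  qed
  also have "\<dots> = sparse_det (Suc n) xss"
    using Suc.prems first_column_eq_sum[OF ne] by simp
  finally show ?case .
qed

text \<open>
  The Sylvester matrix of \<open>f'\<close> and \<open>6 f - x f'\<close> for \<open>f = c\<^sub>1 x + \<dots> + c\<^sub>5 x\<^sup>5\<close>.
\<close>

lemma resultant_sub_sparse:
  fixes c1 :: "'a::comm_ring_1"
  shows "resultant_sub 5 5 [:c1, 2*c2, 3*c3, 4*c4, 5*c5:] [:0, 5*c1, 4*c2, 3*c3, 2*c4, c5:] =
   sparse_det 10
    [[None, Some (5*c5), Some (4*c4), Some (3*c3), Some (2*c2), Some c1, None, None, None, None],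
     [None, None, Some (5*c5), Some (4*c4), Some (3*c3), Some (2*c2), Some c1, None, None, None],
     [None, None, None, Some (5*c5), Some (4*c4), Some (3*c3), Some (2*c2), Some c1, None, None],
     [None, None, None, None, Some (5*c5), Some (4*c4), Some (3*c3), Some (2*c2), Some c1, None],
     [None, None, None, None, None, Some (5*c5), Some (4*c4), Some (3*c3), Some (2*c2), Some c1],
     [Some c5, Some (2*c4), Some (3*c3), Some (4*c2), Some (5*c1), None, None, None, None, None],
     [None, Some c5, Some (2*c4), Some (3*c3), Some (4*c2), Some (5*c1), None, None, None, None],
     [None, None, Some c5, Some (2*c4), Some (3*c3), Some (4*c2), Some (5*c1), None, None, None],
     [None, None, None, Some c5, Some (2*c4), Some (3*c3), Some (4*c2), Some (5*c1), None, None],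
     [None, None, None, None, Some c5, Some (2*c4), Some (3*c3), Some (4*c2), Some (5*c1), None]]"
    (is "_ = sparse_det 10 ?M")
proof -
  have len: "length ?M = 10" "\<forall>r\<in>set ?M. length r = 10" by simp_all
  show ?thesis
  unfolding resultant_sub_def det_sparse_mat[OF len, symmetric]
  proof (rule arg_cong[where f = det], rule eq_matI)
    fix i j assume "i < dim_row (sparse_mat 10 ?M)" "j < dim_col (sparse_mat 10 ?M)"
    hence ij: "i < 10" "j < 10" by (simp_all add: sparse_mat_def)
    hence "i \<in> {0,1,2,3,4,5,6,7,8,9}" "j \<in> {0,1,2,3,4,5,6,7,8,9}" by auto
    thus "sylvester_mat_sub 5 5 [:c1, 2*c2, 3*c3, 4*c4, 5*c5:] [:0, 5*c1, 4*c2, 3*c3, 2*c4, c5:] $$ (i, j) =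
        sparse_mat 10 ?M $$ (i, j)"
      unfolding insert_iff empty_iff
      by (elim disjE; simp add: sparse_mat_def sylvester_mat_sub_def coeff_pCons numeral_eq_Suc)
  qed (simp_all add: sparse_mat_def)
qed


section \<open>Invariants of sextics with the roots zero and infinity\<close>

text \<open>
  The substitution \<open>x \<mapsto> \<lambda> x\<close> and the reversal of the coefficients preserve the set of sextics
  with the roots \<open>0\<close> and \<open>\<infinity>\<close>, and the invariants can be written in terms of \<open>p\<close>, \<open>q\<close>, \<open>c\<^sub>3\<close>
  and \<open>w\<close> below, which are compatible with these operations. For this the identity
  \<open>(c\<^sub>1 c\<^sub>4\<^sup>2) (c\<^sub>2\<^sup>2 c\<^sub>5) = p q\<^sup>2\<close> is used to write the sum of the squares of \<open>c\<^sub>1 c\<^sub>4\<^sup>2\<close>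
  and \<open>c\<^sub>2\<^sup>2 c\<^sub>5\<close> as \<open>w\<^sup>2 - 2 p q\<^sup>2\<close>.
\<close>

lemma coeff_quintic:
  "coeff [:0, c1, c2, c3, c4, c5:] 0 = 0" "coeff [:0, c1, c2, c3, c4, c5:] 1 = c1"
  "coeff [:0, c1, c2, c3, c4, c5:] 2 = c2" "coeff [:0, c1, c2, c3, c4, c5:] 3 = c3"
  "coeff [:0, c1, c2, c3, c4, c5:] 4 = c4" "coeff [:0, c1, c2, c3, c4, c5:] 5 = c5"
  "coeff [:0, c1, c2, c3, c4, c5:] 6 = 0"
  by (simp_all add: coeff_pCons numeral_eq_Suc)

definition toric_J2 :: "'a :: comm_ring_1 \<Rightarrow> 'a \<Rightarrow> 'a \<Rightarrow> 'a" where
  "toric_J2 p q c = 40 * p - 16 * q + 6 * c ^ 2"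

definition toric_J4 :: "'a :: comm_ring_1 \<Rightarrow> 'a \<Rightarrow> 'a \<Rightarrow> 'a \<Rightarrow> 'a" where
  "toric_J4 p q c w = 4 * q ^ 2 + 4 * p * q - 80 * p ^ 2 + 36 * p * c ^ 2 - 12 * c * w"

definition toric_J6 :: "'a :: comm_ring_1 \<Rightarrow> 'a \<Rightarrow> 'a \<Rightarrow> 'a \<Rightarrow> 'a" where
  "toric_J6 p q c w =
    - 320 * p ^ 3 + 64 * p ^ 2 * q + 100 * p * q ^ 2 - 24 * q ^ 3
      + (176 * p ^ 2 - 238 * p * q + 8 * q ^ 2) * c ^ 2 + 72 * p * c ^ 4
      + (26 * p + 76 * q - 24 * c ^ 2) * c * w - 36 * w ^ 2"

text \<open>
  The second factor is the discriminant of the quartic \<open>c\<^sub>1 + c\<^sub>2 x + c\<^sub>3 x\<^sup>2 + c\<^sub>4 x\<^sup>3 + c\<^sub>5 x\<^sup>4\<close>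
  that is left when the roots \<open>0\<close> and \<open>\<infinity>\<close> are split off, and \<open>p\<^sup>2\<close> is the square of the product
  of its values \<open>c\<^sub>1\<close> and \<open>c\<^sub>5\<close> at these two points.
\<close>

definition toric_J10 :: "'a :: comm_ring_1 \<Rightarrow> 'a \<Rightarrow> 'a \<Rightarrow> 'a \<Rightarrow> 'a" where
  "toric_J10 p q c w = p ^ 2 *
    (256 * p ^ 3 - 192 * p ^ 2 * q + 48 * p * q ^ 2 - 4 * q ^ 3
      + (q ^ 2 - 80 * p * q - 128 * p ^ 2) * c ^ 2 + 16 * p * c ^ 4
      + (144 * p + 18 * q - 4 * c ^ 2) * c * w - 27 * w ^ 2)"

lemma igusa_zero_infinity:
  fixes c1 :: "'a :: comm_ring_1"
  assumes "p = c1 * c5" "q = c2 * c4" "w = c1 * c4 ^ 2 + c2 ^ 2 * c5"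
  shows "igusa_J2 [:0, c1, c2, c3, c4, c5:] = toric_J2 p q c3"
    and "igusa_J4 [:0, c1, c2, c3, c4, c5:] = toric_J4 p q c3 w"
    and "igusa_J6 [:0, c1, c2, c3, c4, c5:] = toric_J6 p q c3 w"
  unfolding igusa_J2_def igusa_J4_def igusa_J6_def Let_def coeff_quintic
    toric_J2_def toric_J4_def toric_J6_def assms
  by (simp_all add: algebra_simps power_numeral_reduce)

lemma resultant_sub_zero_infinity:
  fixes c1 :: "'a :: comm_ring_1"
  assumes "p = c1 * c5" "q = c2 * c4" "w = c1 * c4 ^ 2 + c2 ^ 2 * c5"
  shows "resultant_sub 5 5 [:c1, 2*c2, 3*c3, 4*c4, 5*c5:] [:0, 5*c1, 4*c2, 3*c3, 2*c4, c5:] =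
    - 1296 * toric_J10 p q c3 w"
proof -
  have ten: "10 = Suc (Suc (Suc (Suc (Suc (Suc (Suc (Suc (Suc (Suc 0)))))))))"
    by simp
  show ?thesis
    unfolding resultant_sub_sparse toric_J10_def assms
    apply (simp only: ten sparse_det.simps first_column.simps append_Nil append_Cons list.map list.sel)
    \<comment> \<open>The branches that end in 0 are cleared before multiplying out; 608 monomials remain.\<close>
    apply (simp only: mult_zero_left mult_zero_right diff_zero minus_zero diff_0 mult_minus_left
      mult_minus_right minus_minus mult_1_left mult_1_right)
    apply (simp only: ring_distribs minus_mult_left[symmetric])
    apply (simp add: algebra_simps power_numeral_reduce)
    done
qed

lemma igusa_J10_zero_infinity:
  fixes c1 :: "'a :: field"
  assumes "(6 :: 'a) \<noteq> 0"
    and "p = c1 * c5" "q = c2 * c4" "w = c1 * c4 ^ 2 + c2 ^ 2 * c5"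
  shows "igusa_J10 [:0, c1, c2, c3, c4, c5:] = toric_J10 p q c3 w"
proof -
  have "pderiv [:0, c1, c2, c3, c4, c5:] = [:c1, 2*c2, 3*c3, 4*c4, 5*c5:]"
    "smult 6 [:0, c1, c2, c3, c4, c5:] - [:0, 1:] * [:c1, 2*c2, 3*c3, 4*c4, 5*c5:] =
      [:0, 5*c1, 4*c2, 3*c3, 2*c4, c5:]"
    by (simp_all add: pderiv_pCons)
  moreover have "(6 :: 'a) ^ 4 = 1296" by simp
  moreover from this have "(1296 :: 'a) \<noteq> 0" using assms(1) by (metis power_not_zero)
  ultimately show ?thesis
    unfolding igusa_J10_def by (simp only: resultant_sub_zero_infinity[OF assms(2-4)]) simp
qed

text \<open>
  The substitution \<open>x \<mapsto> \<lambda> x\<close> multiplies \<open>p, q, c\<^sub>3, w\<close> by \<open>\<lambda>\<^sup>6, \<lambda>\<^sup>6, \<lambda>\<^sup>3, \<lambda>\<^sup>9\<close>, and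
  \<open>a - 1\<close> occurs in them to the same powers on the family. So the homogeneity that reflects this
  substitution splits off the powers of \<open>v = (a - 1)\<^sup>3\<close>.
\<close>

lemma toric_homogeneous:
  fixes v :: "'a :: comm_ring_1"
  shows "toric_J2 (v ^ 2 * p) (v ^ 2 * q) (v * c) = v ^ 2 * toric_J2 p q c"
    and "toric_J4 (v ^ 2 * p) (v ^ 2 * q) (v * c) (v ^ 3 * w) = (v ^ 2) ^ 2 * toric_J4 p q c w"
    and "toric_J6 (v ^ 2 * p) (v ^ 2 * q) (v * c) (v ^ 3 * w) = (v ^ 2) ^ 3 * toric_J6 p q c w"
    and "toric_J10 (v ^ 2 * p) (v ^ 2 * q) (v * c) (v ^ 3 * w) = (v ^ 2) ^ 5 * toric_J10 p q c w"
  unfolding toric_J2_def toric_J4_def toric_J6_def toric_J10_def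
  by (simp_all add: algebra_simps power_numeral_reduce)

lemma absolute_invariants_weighted:
  fixes f :: "'a :: field poly"
  assumes "m \<noteq> 0"
    and "igusa_J2 f = m * r2" "igusa_J4 f = m ^ 2 * r4" "igusa_J6 f = m ^ 3 * r6" "igusa_J10 f = m ^ 5 * r10"
  shows "abs_inv_i1 f = 144 * r4 / r2 ^ 2"
    and "abs_inv_i2 f = - 1728 * (r2 * r4 - 3 * r6) / r2 ^ 3"
    and "abs_inv_i3 f = 486 * r10 / r2 ^ 5"
proof -
  have cancel: "k * (m ^ n * x) / (m * r2) ^ n = k * x / r2 ^ n" for k x n
    using assms(1) by (simp add: power_mult_distrib)
  have diff: "igusa_J2 f * igusa_J4 f - 3 * igusa_J6 f = m ^ 3 * (r2 * r4 - 3 * r6)"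
    unfolding assms(2-4) by (simp add: algebra_simps power_numeral_reduce)
  show "abs_inv_i1 f = 144 * r4 / r2 ^ 2"
    unfolding abs_inv_i1_def assms(2,3) by (rule cancel)
  show "abs_inv_i2 f = - 1728 * (r2 * r4 - 3 * r6) / r2 ^ 3"
    unfolding abs_inv_i2_def diff unfolding assms(2) by (rule cancel)
  show "abs_inv_i3 f = 486 * r10 / r2 ^ 5"
    unfolding abs_inv_i3_def assms(2,5) by (rule cancel)
qed


section \<open>The invariants of the family in terms of the reduced parameter\<close>

text \<open>
  These are the Igusa invariants of the family without the factors \<open>m\<close>, \<open>m\<^sup>2\<close>, \<open>m\<^sup>3\<close>, \<open>m\<^sup>5\<close>,
  where \<open>m = (a - 1)\<^sup>6 s (s + 4)\<close>. The four functions \<open>red_p\<close>, \<open>red_q\<close>, \<open>red_c\<close>, \<open>red_w\<close> that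
  follow are \<open>c\<^sub>1 c\<^sub>5\<close>, \<open>c\<^sub>2 c\<^sub>4\<close>, \<open>c\<^sub>3\<close>, \<open>c\<^sub>1 c\<^sub>4\<^sup>2 + c\<^sub>2\<^sup>2 c\<^sub>5\<close> without their powers of \<open>a - 1\<close>.
\<close>

definition red_J2 :: "'k :: comm_ring_1 poly" where
  "red_J2 =
   [:2240000, 595200, - 26976, 18576, 6966:]"

definition red_J4 :: "'k :: comm_ring_1 poly" where
  "red_J4 =
   [:- 32000000000, - 477120000000, - 642067200000, - 360333792000, - 104552233920,
    - 16284032640, - 1253366784, - 32472576, 419904:]"

definition red_J6 :: "'k :: comm_ring_1 poly" where
  "red_J6 =
   [:- 32320000000000000, - 284992000000000000, - 385520320000000000, - 224024236800000000,
    - 70491866256000000, - 17027894746368000, - 5817610650931200, - 2080341964730880,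
    - 478916528164992, - 62677218583296, - 4203312943104, - 101462243328, 884317824:]"

definition red_J10 :: "'k :: comm_ring_1 poly" where
  "red_J10 = smult (- 15925248) ([:0, 1:] * [:4, 1:] ^ 2 * [:100, 9:] ^ 5 * [:25, 6:] ^ 5)"

definition red_p :: "'a :: comm_ring_1 \<Rightarrow> 'a" where
  "red_p s = (9 * s + 100) ^ 2 * (6 * s + 25)"

definition red_q :: "'a :: comm_ring_1 \<Rightarrow> 'a" where
  "red_q s = 4000000 + 6160000 * s + 4051600 * s ^ 2 + 1157664 * s ^ 3 + 126576 * s ^ 4 + 756 * s ^ 5
    - 405 * s ^ 6"

definition red_c :: "'a :: comm_ring_1 \<Rightarrow> 'a" where
  "red_c s = 3000 + 2870 * s + 542 * s ^ 2 + 9 * s ^ 3"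

definition red_w :: "'a :: comm_ring_1 \<Rightarrow> 'a" where
  "red_w s = 4000000000 + 7000000000 * s + 5359600000 * s ^ 2 + 2695092000 * s ^ 3
    + 942778080 * s ^ 4 + 215639280 * s ^ 5 + 30468960 * s ^ 6 + 2538378 * s ^ 7
    + 115182 * s ^ 8 + 2187 * s ^ 9"

lemma toric_reduced:
  fixes s :: "'a :: comm_ring_1"
  shows "toric_J2 (red_p s) (red_q s) (red_c s) = s * (s + 4) * poly red_J2 s"
    and "toric_J4 (red_p s) (red_q s) (red_c s) (red_w s) = (s * (s + 4)) ^ 2 * poly red_J4 s"
    and "toric_J6 (red_p s) (red_q s) (red_c s) (red_w s) = (s * (s + 4)) ^ 3 * poly red_J6 s"
    and "toric_J10 (red_p s) (red_q s) (red_c s) (red_w s) = (s * (s + 4)) ^ 5 * poly red_J10 s"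
proof -
  have "poly red_J2 s =
    2240000 + 595200 * s - 26976 * s ^ 2 + 18576 * s ^ 3 + 6966 * s ^ 4"
    unfolding red_J2_def by (simp add: algebra_simps power_numeral_reduce)
  thus "toric_J2 (red_p s) (red_q s) (red_c s) = s * (s + 4) * poly red_J2 s"
    unfolding toric_J2_def red_p_def red_q_def red_c_def
    by (simp only:) (simp add: algebra_simps power_numeral_reduce)
  have "poly red_J4 s =
    -32000000000 - 477120000000 * s - 642067200000 * s ^ 2 - 360333792000 * s ^ 3
    - 104552233920 * s ^ 4 - 16284032640 * s ^ 5 - 1253366784 * s ^ 6 - 32472576 * s ^ 7
    + 419904 * s ^ 8"
    unfolding red_J4_def by (simp add: algebra_simps power_numeral_reduce)
  thus "toric_J4 (red_p s) (red_q s) (red_c s) (red_w s) = (s * (s + 4)) ^ 2 * poly red_J4 s"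
    unfolding toric_J4_def red_p_def red_q_def red_c_def red_w_def
    by (simp only:) (simp add: algebra_simps power_numeral_reduce)
  have "poly red_J6 s =
    -32320000000000000 - 284992000000000000 * s - 385520320000000000 * s ^ 2
    - 224024236800000000 * s ^ 3 - 70491866256000000 * s ^ 4 - 17027894746368000 * s ^ 5
    - 5817610650931200 * s ^ 6 - 2080341964730880 * s ^ 7 - 478916528164992 * s ^ 8
    - 62677218583296 * s ^ 9 - 4203312943104 * s ^ 10 - 101462243328 * s ^ 11
    + 884317824 * s ^ 12"
    unfolding red_J6_def by (simp add: algebra_simps power_numeral_reduce)
  thus "toric_J6 (red_p s) (red_q s) (red_c s) (red_w s) = (s * (s + 4)) ^ 3 * poly red_J6 s"
    unfolding toric_J6_def red_p_def red_q_def red_c_def red_w_def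
    by (simp only:) (simp add: algebra_simps power_numeral_reduce)
  have quartic: "256 * (red_p s) ^ 3 - 192 * (red_p s) ^ 2 * red_q s + 48 * red_p s * red_q s ^ 2
      - 4 * red_q s ^ 3 + (red_q s ^ 2 - 80 * red_p s * red_q s - 128 * red_p s ^ 2) * red_c s ^ 2
      + 16 * red_p s * red_c s ^ 4
      + (144 * red_p s + 18 * red_q s - 4 * red_c s ^ 2) * red_c s * red_w s - 27 * red_w s ^ 2 =
    - 15925248 * s ^ 6 * (s + 4) ^ 7 * (9 * s + 100) * (6 * s + 25) ^ 3"
    unfolding red_p_def red_q_def red_c_def red_w_def
    by (simp add: algebra_simps power_numeral_reduce)
  have regroup: "(z ^ 2 * t) ^ 2 * (- 15925248 * s ^ 6 * y ^ 7 * z * t ^ 3) =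
      (s * y) ^ 5 * (- 15925248 * (s * y ^ 2 * z ^ 5 * t ^ 5))" for y z t
    by (simp add: algebra_simps power_numeral_reduce)
  have "poly red_J10 s = - 15925248 * (s * (s + 4) ^ 2 * (9 * s + 100) ^ 5 * (6 * s + 25) ^ 5)"
    unfolding red_J10_def by (simp add: ac_simps)
  thus "toric_J10 (red_p s) (red_q s) (red_c s) (red_w s) = (s * (s + 4)) ^ 5 * poly red_J10 s"
    unfolding toric_J10_def quartic unfolding red_p_def regroup by (simp only:)
qed

text \<open>
  The coefficients of \<open>sextic_C a\<close> enter only through the following four expressions, where
  \<open>u = a - 1\<close>. The involution \<open>a \<mapsto> a / (a - 1)\<close> is \<open>u \<mapsto> 1 / u\<close>, and it maps \<open>c\<^sub>i\<close> to
  \<open>c\<^bsub>6-i\<^esub> / u\<^sup>6\<close>; so each expression is \<open>u\<^sup>k\<close> times a polynomial of degree at most \<open>k\<close> in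
  \<open>u + 1 / u = s + 2\<close>.
\<close>

lemma sextic_C_coefficients:
  fixes a :: "'a :: field"
  assumes "a \<noteq> 1"
  defines "u \<equiv> a - 1" and "s \<equiv> (a - 2) ^ 2 / (a - 1)"
  obtains c1 c2 c3 c4 c5 where
    "sextic_C a = [:0, c1, c2, c3, c4, c5:]"
    "c1 * c5 = u ^ 6 * red_p s"
    "c2 * c4 = u ^ 6 * red_q s"
    "c3 = u ^ 3 * red_c s"
    "c1 * c4 ^ 2 + c2 ^ 2 * c5 = u ^ 9 * red_w s"
proof -
  have a: "a = u + 1" and us: "u * s = (u - 1) ^ 2"
    using assms(1) by (simp_all add: u_def s_def)
  define c1 where "c1 =
    64 - 368 * a + 673 * a ^ 2 - 454 * a ^ 3 + 44 * a ^ 4 + 38 * a ^ 5 + 3 * a ^ 6"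
  define c2 where "c2 =
    -256 + 1120 * a - 1172 * a ^ 2 - 272 * a ^ 3 + 956 * a ^ 4 - 418 * a ^ 5 + 15 * a ^ 6"
  define c3 where "c3 =
    384 - 1152 * a + 118 * a ^ 2 + 1684 * a ^ 3 - 1468 * a ^ 4 + 434 * a ^ 5 + 9 * a ^ 6"
  define c4 where "c4 =
    -256 + 416 * a + 588 * a ^ 2 - 1120 * a ^ 3 + 468 * a ^ 4 - 54 * a ^ 5 - 27 * a ^ 6"
  define c5 where "c5 =
    64 - 16 * a - 207 * a ^ 2 + 162 * a ^ 3"
  \<comment> \<open>Each polynomial in \<open>s\<close> is made homogeneous in \<open>u s\<close> and \<open>u\<close>, and then \<open>u s = (u - 1)\<^sup>2\<close>.\<close>
  have "c1 * c5 = u ^ 3 * ((9 * (u * s) + 100 * u) ^ 2 * (6 * (u * s) + 25 * u))"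
    unfolding c1_def c5_def us a by (simp add: algebra_simps power_numeral_reduce)
  also have "\<dots> = u ^ 6 * red_p s"
    unfolding red_p_def by (simp add: algebra_simps power_numeral_reduce)
  finally have p: "c1 * c5 = \<dots>" .
  have "c2 * c4 =
      4000000 * (u * s) ^ 0 * u ^ 6 + 6160000 * (u * s) ^ 1 * u ^ 5
      + 4051600 * (u * s) ^ 2 * u ^ 4 + 1157664 * (u * s) ^ 3 * u ^ 3
      + 126576 * (u * s) ^ 4 * u ^ 2 + 756 * (u * s) ^ 5 * u ^ 1 - 405 * (u * s) ^ 6 * u ^ 0"
    unfolding c2_def c4_def us a by (simp add: algebra_simps power_numeral_reduce)
  also have "\<dots> = u ^ 6 * red_q s"
    unfolding red_q_def by (simp add: algebra_simps power_numeral_reduce)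
  finally have q: "c2 * c4 = \<dots>" .
  have "c3 = 3000 * (u * s) ^ 0 * u ^ 3 + 2870 * (u * s) ^ 1 * u ^ 2 + 542 * (u * s) ^ 2 * u ^ 1
      + 9 * (u * s) ^ 3 * u ^ 0"
    unfolding c3_def us a by (simp add: algebra_simps power_numeral_reduce)
  also have "\<dots> = u ^ 3 * red_c s"
    unfolding red_c_def by (simp add: algebra_simps power_numeral_reduce)
  finally have c3: "c3 = \<dots>" .
  have "c1 * c4 ^ 2 + c2 ^ 2 * c5 =
      4000000000 * (u * s) ^ 0 * u ^ 9 + 7000000000 * (u * s) ^ 1 * u ^ 8
      + 5359600000 * (u * s) ^ 2 * u ^ 7 + 2695092000 * (u * s) ^ 3 * u ^ 6
      + 942778080 * (u * s) ^ 4 * u ^ 5 + 215639280 * (u * s) ^ 5 * u ^ 4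
      + 30468960 * (u * s) ^ 6 * u ^ 3 + 2538378 * (u * s) ^ 7 * u ^ 2
      + 115182 * (u * s) ^ 8 * u ^ 1 + 2187 * (u * s) ^ 9 * u ^ 0"
    unfolding c1_def c2_def c4_def c5_def us a by (simp add: algebra_simps power_numeral_reduce)
  also have "\<dots> = u ^ 9 * red_w s"
    unfolding red_w_def by (simp add: algebra_simps power_numeral_reduce)
  finally have w: "c1 * c4 ^ 2 + c2 ^ 2 * c5 = \<dots>" .
  have "sextic_C a = [:0, c1, c2, c3, c4, c5:]"
    unfolding sextic_C_def Let_def c1_def c2_def c3_def c4_def c5_def
    by (simp add: algebra_simps power_numeral_reduce)
  from that[OF this p q c3 w] show ?thesis .
qed

lemma igusa_sextic_C:
  fixes a :: "'a :: field"
  assumes "(6 :: 'a) \<noteq> 0" "a \<noteq> 1"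
  defines "s \<equiv> (a - 2) ^ 2 / (a - 1)"
  defines "m \<equiv> (a - 1) ^ 6 * s * (s + 4)"
  shows "igusa_J2 (sextic_C a) = m * poly red_J2 s"
    and "igusa_J4 (sextic_C a) = m ^ 2 * poly red_J4 s"
    and "igusa_J6 (sextic_C a) = m ^ 3 * poly red_J6 s"
    and "igusa_J10 (sextic_C a) = m ^ 5 * poly red_J10 s"
proof -
  define v where "v = (a - 1) ^ 3"
  have pow: "(a - 1) ^ 6 = v ^ 2" "(a - 1) ^ 9 = v ^ 3"
    by (simp_all add: v_def flip: power_mult)
  have m: "m = v ^ 2 * (s * (s + 4))" by (simp add: m_def pow)
  obtain c1 c2 c3 c4 c5 where f: "sextic_C a = [:0, c1, c2, c3, c4, c5:]"
    and coeffs: "c1 * c5 = v ^ 2 * red_p s" "c2 * c4 = v ^ 2 * red_q s" "c3 = v * red_c s"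
      "c1 * c4 ^ 2 + c2 ^ 2 * c5 = v ^ 3 * red_w s"
    using sextic_C_coefficients[OF assms(2)] unfolding pow v_def[symmetric] s_def[symmetric] .
  note pqw = coeffs(1,2,4)[symmetric]
  show "igusa_J2 (sextic_C a) = m * poly red_J2 s"
    "igusa_J4 (sextic_C a) = m ^ 2 * poly red_J4 s"
    "igusa_J6 (sextic_C a) = m ^ 3 * poly red_J6 s"
    "igusa_J10 (sextic_C a) = m ^ 5 * poly red_J10 s"
    unfolding f igusa_zero_infinity[OF pqw] igusa_J10_zero_infinity[OF assms(1) pqw]
      coeffs(3) toric_homogeneous toric_reduced m power_mult_distrib
    by (simp_all only: mult.assoc)
qed

lemma ratfun_var_eq: "ratfun_var - numeral n = to_fract [:- numeral n, 1:]" "ratfun_var - 1 = to_fract [:- 1, 1:]"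
  "ratfun_var = to_fract [:0, 1:]"
proof -
  have num: "to_fract [:numeral n:] = (numeral n :: ratfun)"
    using const_fract_hom(8)[of n] unfolding const_fract_def .
  have one: "to_fract [:1:] = (1 :: ratfun)"
    using const_fract_hom(2) unfolding const_fract_def .
  show var: "ratfun_var = to_fract [:0, 1:]" by (simp add: ratfun_var_def to_fract_def)
  show "ratfun_var - numeral n = to_fract [:- numeral n, 1:]"
    unfolding var num[symmetric] to_fract_diff[symmetric] by simp
  show "ratfun_var - 1 = to_fract [:- 1, 1:]"
    unfolding var one[symmetric] to_fract_diff[symmetric] by simp
qed

lemma absolute_invariants_C:
  defines "s \<equiv> (ratfun_var - 2) ^ 2 / (ratfun_var - 1)"
  shows "abs_inv_i1 (sextic_C ratfun_var) = fract_eval (smult 144 red_J4) s / fract_eval (red_J2 ^ 2) s"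
    and "abs_inv_i2 (sextic_C ratfun_var) =
      fract_eval (smult (- 1728) (red_J2 * red_J4 - smult 3 red_J6)) s / fract_eval (red_J2 ^ 3) s"
    and "abs_inv_i3 (sextic_C ratfun_var) = fract_eval (smult 486 red_J10) s / fract_eval (red_J2 ^ 5) s"
proof -
  have nz: "ratfun_var \<noteq> 0" "ratfun_var - 1 \<noteq> 0" "ratfun_var - 2 \<noteq> 0"
    unfolding ratfun_var_eq(1,2) by (simp_all add: ratfun_var_eq(3))
  have "s + 4 = ratfun_var ^ 2 / (ratfun_var - 1)"
    using nz unfolding s_def by (simp add: field_simps power2_eq_square)
  hence "(ratfun_var - 1) ^ 6 * s * (s + 4) \<noteq> 0"
    using nz by (simp add: s_def)
  moreover have "ratfun_var \<noteq> 1" using nz by auto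
  moreover have "poly red_J2 s = fract_eval red_J2 s" "poly red_J4 s = fract_eval red_J4 s"
     "poly red_J6 s = fract_eval red_J6 s" "poly red_J10 s = fract_eval red_J10 s"
    by (simp_all add: red_J2_def red_J4_def red_J6_def red_J10_def)
  ultimately have invs:
    "abs_inv_i1 (sextic_C ratfun_var) = 144 * fract_eval red_J4 s / fract_eval red_J2 s ^ 2"
    "abs_inv_i2 (sextic_C ratfun_var) =
      - 1728 * (fract_eval red_J2 s * fract_eval red_J4 s - 3 * fract_eval red_J6 s) / fract_eval red_J2 s ^ 3"
    "abs_inv_i3 (sextic_C ratfun_var) = 486 * fract_eval red_J10 s / fract_eval red_J2 s ^ 5"
    using absolute_invariants_weighted[OF _ igusa_sextic_C[OF ratfun_numeral_nonzero, of ratfun_var]]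
    unfolding s_def[symmetric] by simp_all
  show "abs_inv_i1 (sextic_C ratfun_var) = fract_eval (smult 144 red_J4) s / fract_eval (red_J2 ^ 2) s"
    "abs_inv_i2 (sextic_C ratfun_var) =
      fract_eval (smult (- 1728) (red_J2 * red_J4 - smult 3 red_J6)) s / fract_eval (red_J2 ^ 3) s"
    "abs_inv_i3 (sextic_C ratfun_var) = fract_eval (smult 486 red_J10) s / fract_eval (red_J2 ^ 5) s"
    unfolding invs by (simp_all only: fract_eval_simps const_fract_hom)
qed


section \<open>The fibre through the zero of the reduced parameter\<close>

lemma coprime_linear:
  fixes c d :: "'k :: field_gcd"
  assumes "d \<noteq> 0" "poly F (- c / d) \<noteq> 0"
  shows "coprime F [:c, d:]"
proof -
  have "\<not> [:c, d:] dvd F" using assms by (auto elim!: dvdE)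
  thus ?thesis
    using prime_elem_imp_coprime[OF prime_elem_linear_field_poly[OF assms(1)]]
    by (simp add: coprime_commute)
qed

lemma fibre_i1: "fibre (smult 144 red_J4) (red_J2 ^ 2) (0 :: complex) =
   smult 11059200000000
    [:0, - 30060800000000, - 41851136000000, - 23520512640000, - 6808225843200,
    - 1060852584960, - 81899447328, - 2013707952, 47652543:]"
  unfolding fibre_def red_J4_def red_J2_def by (simp add: power2_eq_square)

lemma fibre_i3: "fibre (smult 486 red_J10) (red_J2 ^ 5) (0 :: complex) =
   smult (486 * 2240000 ^ 5) red_J10"
  unfolding fibre_def red_J10_def by (simp add: red_J2_def)

text \<open>
  The zero \<open>s = 0\<close> of \<open>i\<^sub>3\<close> is simple, and no other finite point has the same values of \<open>i\<^sub>1\<close>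
  and \<open>i\<^sub>3\<close>: the other zeros \<open>-4\<close>, \<open>-100/9\<close>, \<open>-25/6\<close> of \<open>i\<^sub>3\<close> are not zeros of the first fibre.
\<close>

lemma common_divisors_of_fibres:
  fixes R :: "complex poly"
  assumes "R dvd fibre (smult 144 red_J4) (red_J2 ^ 2) 0" "R dvd fibre (smult 486 red_J10) (red_J2 ^ 5) 0"
  shows "degree R \<le> 1"
proof -
  define F :: "complex poly" where "F = fibre (smult 144 red_J4) (red_J2 ^ 2) 0"
  define H :: "complex poly" where "H = [:4, 1:] ^ 2 * [:100, 9:] ^ 5 * [:25, 6:] ^ 5"
  have "coprime F [:4, 1:]" "coprime F [:100, 9:]" "coprime F [:25, 6:]"
    unfolding F_def fibre_i1 by (intro coprime_linear; simp)+
  hence "coprime F H" unfolding H_def by (simp only: coprime_mult_right_iff coprime_power_right_iff) simp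
  hence "coprime R H" using assms(1) unfolding F_def[symmetric] by (metis coprime_divisors dvd_refl)
  have "fibre (smult 486 red_J10) (red_J2 ^ 5) 0 = smult (486 * 2240000 ^ 5 * (- 15925248)) ([:0, 1:] * H)"
    unfolding fibre_i3 unfolding red_J10_def H_def by (simp only: smult_smult mult.assoc)
  with assms(2) have "R dvd smult (486 * 2240000 ^ 5 * (- 15925248)) ([:0, 1:] * H)"
    by (simp only:)
  hence "R dvd [:0, 1:] * H" by (rule dvd_smult_cancel) simp
  hence "R dvd [:0, 1:]" using \<open>coprime R H\<close> by (metis coprime_dvd_mult_left_iff)
  thus ?thesis using dvd_imp_degree_le[of R "[:0, 1:]"] by simp
qed


section \<open>The function field\<close>

theorem proposition4:
  shows "function_field_Y2 = adjoin_C {(ratfun_var / (ratfun_var - 2)) ^ 2}"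
proof -
  define s where "s = (ratfun_var - 2) ^ 2 / (ratfun_var - 1)"
  let ?T = "(ratfun_var / (ratfun_var - 2)) ^ 2"
  have nz: "ratfun_var - 1 \<noteq> 0" "ratfun_var - 2 \<noteq> 0" "s \<noteq> 0"
    unfolding s_def ratfun_var_eq(1,2) by simp_all
  have "s + 4 = ratfun_var ^ 2 / (ratfun_var - 1)"
    using nz unfolding s_def by (simp add: field_simps power2_eq_square)
  hence T: "?T = (s + 4) / s"
    using nz by (simp add: s_def power_divide)
  have "?T - 1 = 4 / s" unfolding T using nz(3) by (simp add: field_simps)
  hence s: "s = 4 / (?T - 1)" using nz(3) ratfun_numeral_nonzero by simp
  interpret T: subfield_set "adjoin_C {?T}" by (rule subfield_set_adjoin_C)
  interpret Y: subfield_set function_field_Y2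
    unfolding function_field_Y2_def by (rule subfield_set_adjoin_C)
  note invs = absolute_invariants_C[folded s_def]
  have const_in: "range const_fract \<subseteq> adjoin_C S" for S
    using adjoin_C_const unfolding ratfun_const_eq by blast
  have four: "4 \<in> adjoin_C S" for S
    using const_in const_fract_hom(8)[of "num.Bit0 (num.Bit0 num.One)"] by (metis range_subsetD)
  show ?thesis
  proof
    have "?T \<in> adjoin_C {?T}" by (rule adjoin_C_incl) simp
    hence "s \<in> adjoin_C {?T}" using four by (subst s) simp
    hence "fract_eval p s \<in> adjoin_C {?T}" for p
      using const_in by (intro fract_eval_in_subfield T.subfield_set_axioms)
    thus "function_field_Y2 \<subseteq> adjoin_C {?T}"
      unfolding function_field_Y2_def invs
      using const_in
      by (intro adjoin_C_least T.subfield_set_axioms) (simp_all add: ratfun_const_eq del: fract_eval_simps)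
  next
    \<comment> \<open>The point \<open>s = 0\<close> is \<open>a = 2\<close>; the denominator \<open>a - 1\<close> of \<open>s\<close> does not vanish there.\<close>
    have s_frac: "s = to_fract ([:- 2, 1:] ^ 2) / to_fract [:- 1, 1:]"
      unfolding s_def ratfun_var_eq(1,2) by (simp only: power2_eq_square to_fract_mult)
    have at_2: "poly ([:- 2, 1:] ^ 2) 2 / poly [:- 1, 1:] (2 :: complex) = 0" by simp
    have "to_fract ([:- 2, 1:] ^ 2) / to_fract [:- 1, 1:] \<in> function_field_Y2"
    proof (rule coordinate_in_subfield[where \<alpha> = 2 and k = 8, OF Y.subfield_set_axioms];
        (unfold at_2 s_frac[symmetric])?)
      show "range const_fract \<subseteq> function_field_Y2"
        using const_in unfolding function_field_Y2_def .
      show "fract_eval (smult 144 red_J4) s / fract_eval (red_J2 ^ 2) s \<in> function_field_Y2"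
        "fract_eval (smult 486 red_J10) s / fract_eval (red_J2 ^ 5) s \<in> function_field_Y2"
        unfolding invs[symmetric] function_field_Y2_def by (auto intro: adjoin_C_incl)
      show "poly (red_J2 ^ 2) (0 :: complex) \<noteq> 0" "poly (red_J2 ^ 5) (0 :: complex) \<noteq> 0"
        by (simp_all add: red_J2_def)
      show "degree (smult 144 red_J4 :: complex poly) \<le> 8" by (simp add: red_J4_def)
      show "degree (red_J2 ^ 2 :: complex poly) \<le> 8"
        using degree_power_le[of "red_J2 :: complex poly" 2] by (simp add: red_J2_def)
      show "degree (fibre (smult 144 red_J4) (red_J2 ^ 2) 0 :: complex poly) = 8"
        "fibre (smult 144 red_J4) (red_J2 ^ 2) 0 \<noteq> (0 :: complex poly)"
        unfolding fibre_i1 by simp_all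
    qed (use common_divisors_of_fibres in simp_all)
    hence "s \<in> function_field_Y2" unfolding s_frac .
    moreover have "4 \<in> function_field_Y2" using four unfolding function_field_Y2_def .
    ultimately have "?T \<in> function_field_Y2" unfolding T by simp
    thus "adjoin_C {?T} \<subseteq> function_field_Y2"
      using const_in unfolding function_field_Y2_def
      by (intro adjoin_C_least subfield_set_adjoin_C) (simp_all add: ratfun_const_eq)
  qed
qed

end
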